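(* Let $(F_k)_{k \ge 0}$ be the Fibonacci sequence. For every integer $n \geq 2$, $$u_{B_n, \mathbb{N}} \geq F_{n+1} F_{n+2} - 1,$$ and for every integer $n \geq 4$, $$u_{D_n, \mathbb{N}} \geq F_n F_{n+1} - 1.$$ Here $u_{\Delta_n,\mathbb{N}}$ denotes the largest positive integer that appears as an entry of a positive integral frieze of type $\Delta_n$.
   Context: The Fibonacci sequence is defined by $F_0 = 0$, $F_1 = 1$, $F_{k+1} = F_k + F_{k-1}$. $\mathbb{N}$ denotes the set of positive integers. Let $\Delta_n$ be a finite Dynkin type of rank $n$ with generalized Cartan matrix $C = (c_{i,j})_{1 \leq i,j \leq n}$. A positive integral frieze of type $\Delta_n$ is an array of positive integers $(x_{i,j})_{1 \leq i \leq n,\, j \in \mathbb{Z}}$ satisfying $$x_{i,j}\, x_{i,j+1} - \prod_{k<i} x_{k,j+1}^{|c_{k,i}|} \prod_{k>i} x_{k,j}^{|c_{k,i}|} = 1$$ for all $i \in \{1,\ldots,n\}$ and $j \in \mathbb{Z}$ (empty products equal $1$). Let $\mathrm{Frieze}(\Delta_n,\mathbb{N})$ be the set of positive integral friezes of type $\Delta_n$, and define $$u_{\Delta_n,\mathbb{N}} := \max\{x_{i,j} : (x_{i,j}) \in \mathrm{Frieze}(\Delta_n,\mathbb{N}),\ 1 \le i \le n,\ j \in \mathbb{Z}\}.$$ (It is known that for finite type $\Delta_n$ this set of values is finite, so the maximum exists.) Cartan matrices used (all diagonal entries are $2$ and all off-diagonal entries not listed are $0$): - Type $B_n$ ($n \geq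 2$): $c_{1,2} = -2$, $c_{2,1} = -1$, and $c_{i,i+1} = c_{i+1,i} = -1$ for $2 \le i \le n-1$. - Type $D_n$ ($n \geq 4$): $c_{1,3} = c_{3,1} = -1$, $c_{2,3} = c_{3,2} = -1$, and $c_{i,i+1} = c_{i+1,i} = -1$ for $3 \le i \le n-1$. *)

theory Defs
  imports "HOL-Library.FuncSet" "HOL-Number_Theory.Fib"
begin

text \<open>
  Cartan matrices are functions on pairs of indices; a matrix of rank \<open>n\<close> is the block of such a
  function on \<open>{1..n}\<close>. For the types $B_n$ and $D_n$ this block is the leading block of a
  single infinite matrix, so \<open>n\<close> is not a parameter of the matrix.
\<close>

definition cartan_B :: "nat \<Rightarrow> nat \<Rightarrow> int" where
  "cartan_B i j =
    (if i = j then 2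
     else if i = 1 \<and> j = 2 then -2
     else if i = 2 \<and> j = 1 then -1
     else if 2 \<le> i \<and> j = i + 1 \<or> 2 \<le> j \<and> i = j + 1 then -1
     else 0)"

definition cartan_D :: "nat \<Rightarrow> nat \<Rightarrow> int" where
  "cartan_D i j =
    (if i = j then 2
     else if i = 1 \<and> j = 3 \<or> i = 3 \<and> j = 1 then -1
     else if i = 2 \<and> j = 3 \<or> i = 3 \<and> j = 2 then -1
     else if 3 \<le> i \<and> j = i + 1 \<or> 3 \<le> j \<and> i = j + 1 then -1
     else 0)"

text \<open>
  The rows of a frieze are indexed by \<open>{1..n}\<close>; extensionality only normalises the
  irrelevant rows outside this range, so that a frieze is determined by its entries.
\<close>

definition Frieze :: "(nat \<Rightarrow> nat \<Rightarrow> int) \<Rightarrow> nat \<Rightarrow> (nat \<Rightarrow> int \<Rightarrow> int) set" where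
  "Frieze C n = {x \<in> extensional {1..n}. \<forall>i\<in>{1..n}. \<forall>j.
     x i j > 0 \<and>
     x i j * x i (j + 1)
       - (\<Prod>k\<in>{1..<i}. x k (j + 1) ^ nat \<bar>C k i\<bar>) * (\<Prod>k\<in>{i<..n}. x k j ^ nat \<bar>C k i\<bar>) = 1}"

text \<open>
  The maximum is meaningful because the set of entries is finite whenever \<open>C\<close> is of finite
  type. (\<open>Max\<close> is unspecified on infinite sets, so bounds on it depend on this finiteness.)
\<close>

definition max_frieze_entry :: "(nat \<Rightarrow> nat \<Rightarrow> int) \<Rightarrow> nat \<Rightarrow> int" where
  "max_frieze_entry C n = Max {x i j | x i j. x \<in> Frieze C n \<and> i \<in> {1..n}}"

end

theory Submission
  imports Defs
begin

text \<open>
  Each inequality needs two things: the entries of all friezes of the given type form a finite set,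
  so that the maximum dominates every entry, and some frieze has the Fibonacci number as an entry.

  Finiteness. Since the entries are at least \<open>1\<close>, every mesh relation \<open>v v' = 1 + u w\<close> implies
  \<open>v v' \<le> 2 u w\<close>. For an entry \<open>h\<close> of the last row of a frieze of type $D_n$, multiply these
  inequalities along the path that descends from \<open>h\<close> to the fork, passes through both short rows
  and climbs back to the last row. All intermediate entries cancel, and what remains is
  \<open>h h' \<le> 4 ^ (n - 1)\<close> for another entry \<open>h' \<ge> 1\<close> of the last row (\<open>Frieze_D_tip_le\<close>). In terms of
  representation theory, the path is the hammock of a boundary vertex of the Auslander-Reiten quiver,
  and the argument replaces the periodicity of the frieze. The mesh relations carry the bound over
  to the other rows. A frieze of type $B_n$ becomes one of type $D_{n+1}$ when its first row is
  written twice (\<open>Frieze_B_unfold\<close>), so type $B$ is finite as well, and only type $B$ needs an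
  explicit frieze: unfolding it gives the bound for type $D$.

  Construction. Let \<open>N = n + 1\<close> and take a path of Farey neighbours
  \<open>0/1 = b 0 / a 0 < \<dots> < b N / a N = 1/1\<close>, continued to both sides by
  \<open>b (t + N) / a (t + N) = b t / a t + 1\<close>. The \<open>2 \<times> 2\<close> determinants of the vectors \<open>(a t, b t)\<close>
  satisfy the Pluecker relations, which are the mesh relations of the long arm. The determinant of a
  vector with its translate by one period is \<open>a t ^ 2\<close>; this square is what the double edge of
  $B_n$ asks for, so the denominators themselves form the first row (\<open>Frieze_B_of_Farey_path\<close>).
  Consecutive denominators \<open>a t\<close>, \<open>a (t + 1)\<close> then give the entry \<open>a t * a (t + 1) - 1\<close> in the second
  row. Inserting, again and again, the mediant next to the largest denominator produces a path of
  \<open>N\<close> steps with neighbouring denominators $F_N$ and $F_{N+1}$ (\<open>Fibonacci_Farey_path\<close>).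
\<close>

section \<open>Mesh relations\<close>

lemma prod_eq_single:
  fixes f :: "'a \<Rightarrow> int"
  assumes "finite A" "a \<in> A" "\<And>k. k \<in> A \<Longrightarrow> k \<noteq> a \<Longrightarrow> f k = 1"
  shows "prod f A = f a"
  using prod.mono_neutral_right[of A "{a}" f] assms by auto

text \<open>
  The value \<open>1\<close> beyond row \<open>n\<close> is the empty product in the last mesh relation; with it, row \<open>n\<close> obeys
  the same relation as the rest of the long arm.
\<close>

definition pad :: "nat \<Rightarrow> (nat \<Rightarrow> int \<Rightarrow> int) \<Rightarrow> nat \<Rightarrow> int \<Rightarrow> int" where
  "pad n x i j = (if i \<le> n then x i j else 1)"

lemma upper_prod_arm:
  assumes "i \<le> n" "\<And>k. i < k \<Longrightarrow> nat \<bar>C k i\<bar> = (if k = i + 1 then 1 else 0)"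
  shows "(\<Prod>k\<in>{i<..n}. x k j ^ nat \<bar>C k i\<bar>) = pad n x (i + 1) j"
proof (cases "i < n")
  case True
  then have "(\<Prod>k\<in>{i<..n}. x k j ^ nat \<bar>C k i\<bar>) = x (i + 1) j ^ nat \<bar>C (i + 1) i\<bar>"
    using assms by (intro prod_eq_single) auto
  then show ?thesis using True assms by (simp add: pad_def)
qed (use assms in \<open>simp add: pad_def\<close>)

lemma lower_prod_arm:
  fixes i :: nat and x :: "nat \<Rightarrow> int \<Rightarrow> int"
  assumes "2 \<le> i" "\<And>k. 1 \<le> k \<Longrightarrow> k < i \<Longrightarrow> nat \<bar>C k i\<bar> = (if k = i - 1 then e else 0)"
  shows "(\<Prod>k\<in>{1..<i}. x k j ^ nat \<bar>C k i\<bar>) = x (i - 1) j ^ e"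
proof -
  have "(\<Prod>k\<in>{1..<i}. x k j ^ nat \<bar>C k i\<bar>) = x (i - 1) j ^ nat \<bar>C (i - 1) i\<bar>"
    using assms by (intro prod_eq_single) auto
  then show ?thesis using assms by simp
qed

lemma Frieze_iff_rows:
  "x \<in> Frieze C n \<longleftrightarrow> x \<in> extensional {1..n} \<and> (\<forall>i\<in>{1..n}. \<forall>j. x i j > 0)
    \<and> (\<forall>i\<in>{1..n}. \<forall>j. x i j * x i (j + 1)
        = 1 + (\<Prod>k\<in>{1..<i}. x k (j + 1) ^ nat \<bar>C k i\<bar>) * (\<Prod>k\<in>{i<..n}. x k j ^ nat \<bar>C k i\<bar>))"
  unfolding Frieze_def by (auto simp: diff_eq_eq)

text \<open>
  In types $B$ and $D$ a vertex of the diagram has at most three neighbours, so the products over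
  the Cartan matrix collapse. After this lemma and its analogue for type $D$, the matrices are
  not consulted again.
\<close>

lemma Frieze_B_iff:
  assumes "n \<ge> 2"
  shows "x \<in> Frieze cartan_B n \<longleftrightarrow> x \<in> extensional {1..n}
    \<and> (\<forall>i\<in>{1..n}. \<forall>j. x i j > 0)
    \<and> (\<forall>j. x 1 j * x 1 (j + 1) = 1 + x 2 j)
    \<and> (\<forall>j. x 2 j * x 2 (j + 1) = 1 + x 1 (j + 1) ^ 2 * pad n x 3 j)
    \<and> (\<forall>i\<in>{3..n}. \<forall>j. x i j * x i (j + 1) = 1 + x (i - 1) (j + 1) * pad n x (i + 1) j)"
proof -
  have up: "(\<Prod>k\<in>{i<..n}. x k j ^ nat \<bar>cartan_B k i\<bar>) = pad n x (i + 1) j"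
    if "1 \<le> i" "i \<le> n" for i j
    using that by (intro upper_prod_arm) (auto simp: cartan_B_def)
  have low: "(\<Prod>k\<in>{1..<i}. x k j ^ nat \<bar>cartan_B k i\<bar>) = x (i - 1) j ^ (if i = 2 then 2 else 1)"
    if "2 \<le> i" for i j
    using that by (intro lower_prod_arm) (auto simp: cartan_B_def)
  have rows: "(\<forall>i\<in>{1..n}. R i) \<longleftrightarrow> R 1 \<and> R 2 \<and> (\<forall>i\<in>{3..n}. R i)" for R :: "nat \<Rightarrow> bool"
  proof -
    have "{1..n} = {1, 2} \<union> {3..n}" using assms by auto
    then show ?thesis by (simp add: ball_Un)
  qed
  have "(\<forall>i\<in>{1..n}. \<forall>j. x i j * x i (j + 1) = 1
      + (\<Prod>k\<in>{1..<i}. x k (j + 1) ^ nat \<bar>cartan_B k i\<bar>) * (\<Prod>k\<in>{i<..n}. x k j ^ nat \<bar>cartan_B k i\<bar>))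
    \<longleftrightarrow> (\<forall>j. x 1 j * x 1 (j + 1) = 1 + x 2 j)
    \<and> (\<forall>j. x 2 j * x 2 (j + 1) = 1 + x 1 (j + 1) ^ 2 * pad n x 3 j)
    \<and> (\<forall>i\<in>{3..n}. \<forall>j. x i j * x i (j + 1) = 1 + x (i - 1) (j + 1) * pad n x (i + 1) j)"
    unfolding rows
  proof (intro arg_cong2[of _ _ _ _ "(\<and>)"] ball_cong refl, goal_cases)
    case 1
    show ?case using up[of 1] assms by (simp add: pad_def numeral_2_eq_2)
  next
    case 2
    show ?case using up[of 2] low[of 2] assms by simp
  next
    case (3 i)
    show ?case using up[of i] low[of i] 3 by simp
  qed
  then show ?thesis unfolding Frieze_iff_rows by blast
qed

lemma Frieze_D_iff:
  assumes "n \<ge> 3"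
  shows "x \<in> Frieze cartan_D n \<longleftrightarrow> x \<in> extensional {1..n}
    \<and> (\<forall>i\<in>{1..n}. \<forall>j. x i j > 0)
    \<and> (\<forall>j. x 1 j * x 1 (j + 1) = 1 + x 3 j)
    \<and> (\<forall>j. x 2 j * x 2 (j + 1) = 1 + x 3 j)
    \<and> (\<forall>j. x 3 j * x 3 (j + 1) = 1 + x 1 (j + 1) * x 2 (j + 1) * pad n x 4 j)
    \<and> (\<forall>i\<in>{4..n}. \<forall>j. x i j * x i (j + 1) = 1 + x (i - 1) (j + 1) * pad n x (i + 1) j)"
proof -
  have up: "(\<Prod>k\<in>{i<..n}. x k j ^ nat \<bar>cartan_D k i\<bar>) = pad n x (i + 1) j"
    if "3 \<le> i" "i \<le> n" for i j
    using that by (intro upper_prod_arm) (auto simp: cartan_D_def)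
  have up12: "(\<Prod>k\<in>{i<..n}. x k j ^ nat \<bar>cartan_D k i\<bar>) = x 3 j" if "i = 1 \<or> i = 2" for i j
    using prod_eq_single[of "{i<..n}" 3 "\<lambda>k. x k j ^ nat \<bar>cartan_D k i\<bar>"] that assms
    by (auto simp: cartan_D_def)
  have low: "(\<Prod>k\<in>{1..<i}. x k j ^ nat \<bar>cartan_D k i\<bar>) = x (i - 1) j ^ 1" if "4 \<le> i" for i j
    using that by (intro lower_prod_arm) (auto simp: cartan_D_def)
  have low123: "{1..<2} = {1::nat}" "{1..<3} = {1::nat, 2}" by auto
  have rows: "(\<forall>i\<in>{1..n}. R i) \<longleftrightarrow> R 1 \<and> R 2 \<and> R 3 \<and> (\<forall>i\<in>{4..n}. R i)" for R :: "nat \<Rightarrow> bool"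
  proof -
    have "{1..n} = {1, 2, 3} \<union> {4..n}" using assms by auto
    then show ?thesis by (simp add: ball_Un)
  qed
  have "(\<forall>i\<in>{1..n}. \<forall>j. x i j * x i (j + 1) = 1
      + (\<Prod>k\<in>{1..<i}. x k (j + 1) ^ nat \<bar>cartan_D k i\<bar>) * (\<Prod>k\<in>{i<..n}. x k j ^ nat \<bar>cartan_D k i\<bar>))
    \<longleftrightarrow> (\<forall>j. x 1 j * x 1 (j + 1) = 1 + x 3 j)
    \<and> (\<forall>j. x 2 j * x 2 (j + 1) = 1 + x 3 j)
    \<and> (\<forall>j. x 3 j * x 3 (j + 1) = 1 + x 1 (j + 1) * x 2 (j + 1) * pad n x 4 j)
    \<and> (\<forall>i\<in>{4..n}. \<forall>j. x i j * x i (j + 1) = 1 + x (i - 1) (j + 1) * pad n x (i + 1) j)"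
    unfolding rows
  proof (intro arg_cong2[of _ _ _ _ "(\<and>)"] ball_cong refl, goal_cases)
    case 1
    show ?case using up12[of 1] by simp
  next
    case 2
    show ?case using up12[of 2] unfolding low123 by (simp add: cartan_D_def)
  next
    case 3
    show ?case using up[of 3] assms unfolding low123 by (simp add: cartan_D_def)
  next
    case (4 i)
    show ?case using up[of i] low[of i] 4 by simp
  qed
  then show ?thesis unfolding Frieze_iff_rows by blast
qed

section \<open>Boundedness in type $D$\<close>

text \<open>
  One step along the path of meshes: a bound on \<open>h\<close> by the ratio of two neighbouring entries is
  carried across a mesh to the next ratio, at the cost of a factor \<open>2\<close>.
\<close>

lemma cancel_mesh:
  fixes h u v v' w c :: int
  assumes "h * u \<le> c * v" "v * v' \<le> 2 * (w * u)" "0 < u" "0 < v" "0 < v'" "0 \<le> c"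
  shows "h * v' \<le> (2 * c) * w"
proof -
  have "(h * u) * (v * v') \<le> (c * v) * (2 * (w * u))"
    using assms by (intro mult_mono[of "h * u" _ "v * v'"]) simp_all
  then have "(h * v') * (u * v) \<le> ((2 * c) * w) * (u * v)" by (simp add: algebra_simps)
  then show ?thesis using assms by (simp add: mult_le_cancel_right)
qed

text \<open>
  The two short rows enter only through the product \<open>P\<close> of their entries, whose own mesh inequality
  is the product of theirs; hence the walk down the arm, across \<open>P\<close> and up again behaves like a walk
  along a line reflected at its end. It crosses \<open>n - 2\<close> meshes on the way down, \<open>n - 2\<close> on the way
  up, and one mesh in each of the two short rows, so the total factor is \<open>2 ^ (2 * n - 2)\<close>.
\<close>

lemma Frieze_D_tip_le:
  assumes n: "n \<ge> 3" and x: "x \<in> Frieze cartan_D n"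
  shows "x n j \<le> 4 ^ (n - 1)"
proof -
  note rel = x[unfolded Frieze_D_iff[OF n]]
  define y where "y = pad n x"
  define P where "P t = y 1 t * y 2 t" for t
  have y_pos: "0 < y i t" if "1 \<le> i" for i t
    using rel that by (auto simp: y_def pad_def)
  have P_pos: "0 < P t" for t by (simp add: P_def y_pos)
  have mesh: "y i t * y i (t + 1) \<le> 2 * (y (i - 1) (t + 1) * y (i + 1) t)"
    if "i \<in> {4..n}" for i t
  proof -
    have "0 < y (i - 1) (t + 1) * y (i + 1) t" using that by (intro mult_pos_pos y_pos) auto
    moreover have "y i t * y i (t + 1) = 1 + y (i - 1) (t + 1) * y (i + 1) t"
      using rel that by (auto simp: y_def pad_def)
    ultimately show ?thesis by linarith
  qed
  have mesh3: "y 3 t * y 3 (t + 1) \<le> 2 * (P (t + 1) * y 4 t)" for t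
  proof -
    have "0 < P (t + 1) * y 4 t" using y_pos P_pos by simp
    moreover have "y 3 t * y 3 (t + 1) = 1 + P (t + 1) * y 4 t"
      using rel n by (auto simp: y_def pad_def P_def)
    ultimately show ?thesis by linarith
  qed
  have mesh12: "P t * P (t + 1) \<le> 2 * ((2 * y 3 t) * y 3 t)" for t
  proof -
    have "P t * P (t + 1) = (y 1 t * y 1 (t + 1)) * (y 2 t * y 2 (t + 1))"
      by (simp add: P_def algebra_simps)
    also have "\<dots> = (1 + y 3 t) * (1 + y 3 t)" using rel n by (auto simp: y_def pad_def)
    also have "\<dots> \<le> (2 * y 3 t) * (2 * y 3 t)"
      using y_pos[of 3 t] by (intro mult_mono) auto
    finally show ?thesis by (simp add: algebra_simps)
  qed
  define h where "h = y n j"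
  \<comment> \<open>The descent from row \<open>n\<close> to row \<open>4\<close>, one column forward per row; the padded row \<open>n + 1\<close> starts it.\<close>
  have down: "h * y (n + 1 - k) (j + int k) \<le> 2 ^ k * y (n - k) (j + int k)" if "k \<le> n - 3" for k
    using that
  proof (induction k)
    case 0
    show ?case by (simp add: h_def y_def pad_def)
  next
    case (Suc k)
    have s: "n - k - 1 = n - Suc k" "n + 1 - k = n - k + 1" "n + 1 - Suc k = n - k"
      using Suc.prems by auto
    have IH: "h * y (n - k + 1) (j + int k) \<le> 2 ^ k * y (n - k) (j + int k)"
      using Suc s by simp
    have "h * y (n - k) (j + int k + 1) \<le> (2 * 2 ^ k) * y (n - k - 1) (j + int k + 1)"
      by (rule cancel_mesh[OF IH mesh]) (use Suc.prems y_pos n in auto)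
    then show ?case using s by (simp add: algebra_simps)
  qed
  define c :: int where "c = 2 ^ (n - 3)"
  have c: "0 \<le> c" by (simp add: c_def)
  define t where "t = j + int (n - 3)"
  have h1: "h * y 4 t \<le> c * y 3 t"
    using down[of "n - 3"] n by (simp add: c_def t_def)
  \<comment> \<open>The turn at the fork: across row \<open>3\<close>, then \<open>P\<close>, then row \<open>3\<close> again.\<close>
  have h2: "h * y 3 (t + 1) \<le> (2 * c) * P (t + 1)"
    by (rule cancel_mesh[OF h1 mesh3]) (use c y_pos in auto)
  have h3: "h * P (t + 2) \<le> (2 * (2 * c)) * (2 * y 3 (t + 1))"
    using cancel_mesh[OF h2 mesh12] c y_pos[of 3] P_pos by (simp add: add.assoc)
  then have h3': "h * P (t + 2) \<le> (8 * c) * y 3 (t + 1)" by simp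
  have h4: "h * y 3 (t + 2) \<le> (16 * c) * y 4 (t + 1)"
    using cancel_mesh[OF h3', of "y 3 (t + 2)" "y 4 (t + 1)"] mesh3[of "t + 1"] c y_pos[of 3] P_pos
    by (simp add: add.assoc mult.commute)
  \<comment> \<open>The ascent within fixed columns; the padded row \<open>n + 1\<close> ends it with a constant.\<close>
  have up: "h * y (3 + k) (t + 2) \<le> (2 ^ k * (16 * c)) * y (4 + k) (t + 1)" if "k \<le> n - 3" for k
    using that
  proof (induction k)
    case 0
    show ?case using h4 by simp
  next
    case (Suc k)
    have m: "y (4 + k) (t + 1) * y (4 + k) (t + 2) \<le> 2 * (y (5 + k) (t + 1) * y (3 + k) (t + 2))"
      using mesh[of "4 + k" "t + 1"] Suc.prems by (simp add: add.assoc mult.commute)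
    have IH: "h * y (3 + k) (t + 2) \<le> (2 ^ k * (16 * c)) * y (4 + k) (t + 1)"
      using Suc by simp
    show ?case
      using cancel_mesh[OF IH m] c y_pos by (simp add: algebra_simps)
  qed
  have "h * y n (t + 2) \<le> 2 ^ (n - 3) * (16 * c)"
    using up[of "n - 3"] n by (simp add: y_def pad_def)
  also have "\<dots> = 4 ^ (n - 3) * 4 ^ 2"
    by (simp add: c_def power_mult_distrib[symmetric])
  also have "\<dots> = 4 ^ (n - 1)"
    unfolding power_add[symmetric] using n by (intro arg_cong[of _ _ "power 4"]) simp
  finally have "h * y n (t + 2) \<le> 4 ^ (n - 1)" .
  moreover have "h * 1 \<le> h * y n (t + 2)"
    using y_pos[of n "t + 2"] y_pos[of n j] n by (intro mult_left_mono) (auto simp: h_def)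
  ultimately show ?thesis by (simp add: h_def y_def pad_def)
qed

text \<open>
  An entry of row \<open>i\<close> is a factor of \<open>y y' - 1\<close> for two consecutive entries \<open>y\<close>, \<open>y'\<close> of row
  \<open>i + 1\<close>, so a bound \<open>K\<close> for row \<open>i + 1\<close> gives the bound \<open>K * K\<close> for row \<open>i\<close>.
\<close>

lemma Frieze_D_row_bounded:
  assumes n: "n \<ge> 3" and i: "3 \<le> i" "i \<le> n"
  shows "\<exists>K. \<forall>x\<in>Frieze cartan_D n. \<forall>j. x i j \<le> K"
  using i(2,1)
proof (induction i rule: inc_induct)
  case base
  show ?case using Frieze_D_tip_le[OF n] by blast
next
  case (step i)
  then obtain K where K: "\<And>x j. x \<in> Frieze cartan_D n \<Longrightarrow> x (Suc i) j \<le> K" by auto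
  have "x i j \<le> K * K" if x: "x \<in> Frieze cartan_D n" for x j
  proof -
    note rel = x[unfolded Frieze_D_iff[OF n]]
    have pos: "0 < x (Suc i) t" "0 < x i t" "0 < pad n x (Suc (Suc i)) t" for t
      using rel step by (auto simp: pad_def)
    have "x i j * 1 \<le> x i j * pad n x (Suc (Suc i)) (j - 1)"
      using pos(2)[of j] pos(3)[of "j - 1"] by (intro mult_left_mono) auto
    also have "\<dots> \<le> x (Suc i) (j - 1) * x (Suc i) j"
      using rel step by (auto dest!: bspec[of "{4..n}" _ "Suc i"] spec[of _ "j - 1"])
    also have "\<dots> \<le> K * K"
      using K[OF x, of j] K[OF x, of "j - 1"] pos(1)[of j] pos(1)[of "j - 1"]
      by (intro mult_mono) auto
    finally show ?thesis by simp
  qed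
  then show ?case by blast
qed

lemma Frieze_D_bounded:
  assumes n: "n \<ge> 3"
  shows "\<exists>K. \<forall>x\<in>Frieze cartan_D n. \<forall>i\<in>{1..n}. \<forall>j. x i j \<le> K"
proof -
  have "\<exists>K. \<forall>x\<in>Frieze cartan_D n. \<forall>j. x i j \<le> K" if i: "i \<in> {1..n}" for i
  proof (cases "3 \<le> i")
    case True
    then show ?thesis using Frieze_D_row_bounded[OF n] i by auto
  next
    case False
    then have i12: "i = 1 \<or> i = 2" using i by auto
    obtain K where K: "\<And>x j. x \<in> Frieze cartan_D n \<Longrightarrow> x 3 j \<le> K"
      using Frieze_D_row_bounded[OF n order.refl n] by auto
    have "x i j \<le> 1 + K" if x: "x \<in> Frieze cartan_D n" for x j
    proof -
      note rel = x[unfolded Frieze_D_iff[OF n]]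
      have pos: "0 < x i t" for t using rel i by auto
      have "x i j * 1 \<le> x i j * x i (j + 1)"
        using pos[of j] pos[of "j + 1"] by (intro mult_left_mono) auto
      also have "\<dots> = 1 + x 3 j" using rel i12 by auto
      finally show ?thesis using K[OF x, of j] by simp
    qed
    then show ?thesis by blast
  qed
  then obtain K where K: "\<And>i x j. i \<in> {1..n} \<Longrightarrow> x \<in> Frieze cartan_D n \<Longrightarrow> x i j \<le> K i"
    by metis
  have "x i j \<le> Max (K ` {1..n})" if "i \<in> {1..n}" "x \<in> Frieze cartan_D n" for i x j
    using K[OF that, of j] that(1) by (meson Max_ge finite_atLeastAtMost finite_imageI imageI order_trans)
  then show ?thesis by blast
qed

definition entries :: "(nat \<Rightarrow> nat \<Rightarrow> int) \<Rightarrow> nat \<Rightarrow> int set" where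
  "entries C n = {x i j | x i j. x \<in> Frieze C n \<and> i \<in> {1..n}}"

lemma finite_entries_D:
  assumes "n \<ge> 3"
  shows "finite (entries cartan_D n)"
proof -
  obtain K where K: "\<forall>x\<in>Frieze cartan_D n. \<forall>i\<in>{1..n}. \<forall>j. x i j \<le> K"
    using Frieze_D_bounded[OF assms] by blast
  have "0 < x i j" if "x \<in> Frieze cartan_D n" "i \<in> {1..n}" for x i j
    using that unfolding Frieze_iff_rows by blast
  with K have "entries cartan_D n \<subseteq> {0<..K}"
    unfolding entries_def by fastforce
  then show ?thesis by (rule finite_subset) simp
qed

section \<open>Type $B$ as folded type $D$\<close>

text \<open>
  The two short rows of $D_{n+1}$ are exchanged by a symmetry of the diagram. When they agree,
  their product in the relation of row \<open>3\<close> is the square demanded by the entry \<open>-2\<close> of the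
  matrix of $B_n$.
\<close>

lemma Frieze_B_unfold:
  assumes n: "n \<ge> 2" and x: "x \<in> Frieze cartan_B n"
  shows "(\<lambda>i\<in>{1..n + 1}. x (if i = 1 then 1 else i - 1)) \<in> Frieze cartan_D (n + 1)"
    (is "?z \<in> _")
proof -
  have D: "3 \<le> n + 1" using n by simp
  have xpos: "0 < x i j" if "i \<in> {1..n}" for i j
    using x[unfolded Frieze_B_iff[OF n]] that by blast
  have x1: "x 1 j * x 1 (j + 1) = 1 + x 2 j"
    and x2: "x 2 j * x 2 (j + 1) = 1 + x 1 (j + 1) ^ 2 * pad n x 3 j" for j
    using x[unfolded Frieze_B_iff[OF n]] by blast+
  have x3: "x i j * x i (j + 1) = 1 + x (i - 1) (j + 1) * pad n x (i + 1) j"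
    if "i \<in> {3..n}" for i j
    using x[unfolded Frieze_B_iff[OF n]] that by blast
  define z where "z = ?z"
  have z1: "z 1 = x 1" by (simp add: z_def)
  have z: "z i = x (i - 1)" if "i \<in> {2..n + 1}" for i using that by (auto simp: z_def)
  have z23: "z 2 = x 1" "z 3 = x 2" using z[of 2] z[of 3] n by simp_all
  have z_ext: "z \<in> extensional {1..n + 1}" unfolding z_def by (rule restrict_extensional)
  have pad: "pad (n + 1) z (i + 1) = pad n x i" if "1 \<le> i" for i
    using that by (auto simp: pad_def z)
  have pos: "0 < z i j" if "i \<in> {1..n + 1}" for i j
  proof (cases "i = 1")
    case True
    show ?thesis unfolding True z1 by (rule xpos) (use n in simp)
  next
    case False
    then have "i \<in> {2..n + 1}" "i - 1 \<in> {1..n}" using that by auto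
    then show ?thesis using z xpos by simp
  qed
  have fork: "z 1 j * z 1 (j + 1) = 1 + z 3 j" "z 2 j * z 2 (j + 1) = 1 + z 3 j" for j
    unfolding z1 z23 by (rule x1)+
  have branch: "z 3 j * z 3 (j + 1) = 1 + z 1 (j + 1) * z 2 (j + 1) * pad (n + 1) z 4 j" for j
    using x2[of j] pad[of 3] unfolding z1 z23 by (simp add: power2_eq_square)
  have arm: "z i j * z i (j + 1) = 1 + z (i - 1) (j + 1) * pad (n + 1) z (i + 1) j"
    if i: "i \<in> {4..n + 1}" for i j
  proof -
    have i': "i - 1 \<in> {3..n}" "i - 1 + 1 = i" using i by auto
    have m: "i \<in> {2..n + 1}" "i - 1 \<in> {2..n + 1}" "1 \<le> i" using i by auto
    show ?thesis
      unfolding z[OF m(1)] z[OF m(2)] pad[OF m(3)] using x3[OF i'(1), of j] unfolding i'(2) .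
  qed
  have "z \<in> Frieze cartan_D (n + 1)"
    unfolding Frieze_D_iff[OF D] using z_ext pos fork branch arm by blast
  then show ?thesis unfolding z_def .
qed

lemma entries_B_subset_D:
  assumes "n \<ge> 2"
  shows "entries cartan_B n \<subseteq> entries cartan_D (n + 1)"
proof
  fix e assume "e \<in> entries cartan_B n"
  then obtain x i j where e: "e = x i j" "x \<in> Frieze cartan_B n" "i \<in> {1..n}"
    by (auto simp: entries_def)
  let ?z = "\<lambda>i\<in>{1..n + 1}. x (if i = 1 then 1 else i - 1)"
  have "e = ?z (i + 1) j" "i + 1 \<in> {1..n + 1}" using e by auto
  then show "e \<in> entries cartan_D (n + 1)"
    using Frieze_B_unfold[OF assms e(2)] unfolding entries_def by blast
qed

section \<open>Friezes from Farey paths\<close>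

text \<open>
  The fractions \<open>b t / a t\<close> have positive denominators and increase at each step, so they increase
  along the whole path. The induction uses the three-term relation between the determinants of three
  vectors, which avoids division.
\<close>

lemma Farey_path_det_pos:
  fixes a b :: "int \<Rightarrow> int"
  assumes pos: "\<And>t. 0 < a t" and step: "\<And>t. a t * b (t + 1) - a (t + 1) * b t = 1"
    and "s < t"
  shows "0 < a s * b t - a t * b s"
  using \<open>s < t\<close>
proof (induction t rule: int_gr_induct)
  case base
  show ?case using step[of s] by simp
next
  case (step t)
  have "a t * (a s * b (t + 1) - a (t + 1) * b s)
      = a (t + 1) * (a s * b t - a t * b s) + a s * (a t * b (t + 1) - a (t + 1) * b t)"
    by (simp add: algebra_simps)
  also have "\<dots> > 0"
    using step.IH pos[of "t + 1"] pos[of s] assms(2)[of t] by (simp add: add_pos_pos)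
  finally show ?case using pos[of t] by (simp add: zero_less_mult_iff)
qed

text \<open>
  The vector \<open>v t = (a t, b t)\<close> satisfies \<open>v (t + n + 1) = M (v t)\<close> with the shear
  \<open>M (a, b) = (a, a + b)\<close>, and \<open>det (v, M v) = p * p\<close> while \<open>det (v, M w) = det (v, w) + p * q\<close>,
  where \<open>p\<close> and \<open>q\<close> are the first coordinates of \<open>v\<close> and \<open>w\<close>. The first identity makes the
  determinant formula of the rows from \<open>2\<close> to \<open>n\<close> produce the square of row \<open>1\<close> when it is
  evaluated at row \<open>1\<close>, the second gives the relation of row \<open>1\<close>, and unimodularity of consecutive
  vectors puts \<open>1\<close> in row \<open>n + 1\<close>.
\<close>

lemma Frieze_B_of_Farey_path:
  fixes a b :: "int \<Rightarrow> int"
  assumes n: "n \<ge> 2" and pos: "\<And>t. 0 < a t"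
    and step: "\<And>t. a t * b (t + 1) - a (t + 1) * b t = 1"
    and a_per: "\<And>t. a (t + int (n + 1)) = a t"
    and b_per: "\<And>t. b (t + int (n + 1)) = b t + a t"
  defines "d \<equiv> \<lambda>s t. a s * b t - a t * b s"
  shows "(\<lambda>i\<in>{1..n}. \<lambda>j. if i = 1 then a (j + 1) else d (j + int i) (j + int n + 2))
      \<in> Frieze cartan_B n"
    (is "?x \<in> _")
proof -
  have d_pos: "0 < d s t" if "s < t" for s t
    using Farey_path_det_pos[of a b, OF pos step that] by (simp add: d_def)
  have per: "a (t + int n + 2) = a (t + 1)" "b (t + int n + 2) = b (t + 1) + a (t + 1)" for t
    using a_per[of "t + 1"] b_per[of "t + 1"] by (simp_all add: add_ac)
  have d_loop: "d (j + 2) (j + int n + 3) = a (j + 2) ^ 2" for j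
    using per[of "j + 1"] by (simp add: d_def power2_eq_square algebra_simps)
  have d_last: "d (j + int n + 1) (j + int n + 2) = 1" for j
    using step[of "j + int n + 1"] by (simp add: d_def add_ac)
  have Plucker: "d (j + i) (j + int n + 2) * d (j + i + 1) (j + int n + 3)
      = 1 + d (j + i) (j + int n + 3) * d (j + i + 1) (j + int n + 2)" for i j
  proof -
    have "d (j + i) (j + int n + 2) * d (j + i + 1) (j + int n + 3)
      = d (j + i) (j + i + 1) * d (j + int n + 2) (j + int n + 3)
        + d (j + i) (j + int n + 3) * d (j + i + 1) (j + int n + 2)"
      by (simp add: d_def algebra_simps)
    moreover have "d (j + i) (j + i + 1) = 1" "d (j + int n + 2) (j + int n + 3) = 1"
      using step[of "j + i"] step[of "j + int n + 2"] by (simp_all add: d_def add_ac)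
    ultimately show ?thesis by simp
  qed
  define x where "x = ?x"
  have row: "x i j = d (j + int i) (j + int n + 2)" if "i \<in> {2..n}" for i j
    using that by (auto simp: x_def)
  have row1: "x 1 j = a (j + 1)" for j using n by (auto simp: x_def)
  have padded: "pad n x (i + 1) j = d (j + int i + 1) (j + int n + 2)" if "i \<in> {2..n}" for i j
    using that d_last[of j] row[of "i + 1" j] by (cases "i = n") (auto simp: pad_def add_ac)
  have pad3: "pad n x 3 j = d (j + 3) (j + int n + 2)" for j
    using padded[of 2 j] n by (simp add: numeral_3_eq_3 add.commute add.left_commute)
  have x_pos: "0 < x i j" if "i \<in> {1..n}" for i j
    using that pos d_pos by (auto simp: x_def)
  have r1: "x 1 j * x 1 (j + 1) = 1 + x 2 j" for j
    using n row[of 2 j] per[of j] step[of "j + 1"] unfolding row1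
    by (simp add: d_def algebra_simps)
  have r2: "x 2 j * x 2 (j + 1) = 1 + x 1 (j + 1) ^ 2 * pad n x 3 j" for j
    using n row[of 2 j] row[of 2 "j + 1"] Plucker[of j 2] d_loop[of j] unfolding row1 pad3
    by (simp add: add_ac)
  have r3: "x i j * x i (j + 1) = 1 + x (i - 1) (j + 1) * pad n x (i + 1) j"
    if i: "i \<in> {3..n}" for i j
  proof -
    have "int (i - 1) = int i - 1" "i \<in> {2..n}" "i - 1 \<in> {2..n}" using i by auto
    then show ?thesis
      using row[of i j] row[of i "j + 1"] row[of "i - 1" "j + 1"] padded[of i j] Plucker[of j "int i"]
      by (simp add: algebra_simps)
  qed
  have "x \<in> extensional {1..n}" unfolding x_def by (rule restrict_extensional)
  then have "x \<in> Frieze cartan_B n"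
    unfolding Frieze_B_iff[OF n] using x_pos r1 r2 r3 by blast
  then show ?thesis unfolding x_def .
qed

text \<open>
  The mediant of two Farey neighbours is a Farey neighbour of both. Between denominators $F_N$ and
  $F_{N+1}$ it has denominator $F_{N+2}$, and it is adjacent to $F_{N+1}$ on one side. The side
  alternates with \<open>N\<close>; stating the pair of denominators as a set avoids tracking it.
\<close>

lemma Fibonacci_Farey_path:
  assumes "N \<ge> 1"
  shows "\<exists>a b :: nat \<Rightarrow> int. a 0 = 1 \<and> b 0 = 0 \<and> a N = 1 \<and> b N = 1
    \<and> (\<forall>t\<le>N. 0 < a t) \<and> (\<forall>t<N. a t * b (t + 1) - a (t + 1) * b t = 1)
    \<and> (\<exists>t<N. {a t, a (t + 1)} = {int (fib N), int (fib (N + 1))})"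
  using assms
proof (induction N rule: dec_induct)
  case base
  show ?case by (rule exI[of _ "\<lambda>_. 1"], rule exI[of _ int]) auto
next
  case (step N)
  then obtain a b :: "nat \<Rightarrow> int" and m where
    ends: "a 0 = 1" "b 0 = 0" "a N = 1" "b N = 1"
    and pos: "\<And>t. t \<le> N \<Longrightarrow> 0 < a t"
    and det: "\<And>t. t < N \<Longrightarrow> a t * b (t + 1) - a (t + 1) * b t = 1"
    and m: "m < N" "{a m, a (m + 1)} = {int (fib N), int (fib (N + 1))}"
    by blast
  \<comment> \<open>Applied to \<open>a\<close> and \<open>b\<close>, this puts the mediant of the vectors at \<open>m\<close> and \<open>m + 1\<close> between them.\<close>
  define ins where "ins f t = (if t \<le> m then f t else if t = m + 1 then f m + f (m + 1) else f (t - 1))"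
    for f :: "nat \<Rightarrow> int" and t
  have new: "ins a (m + 1) = int (fib (N + 2))"
    using m by (auto simp: ins_def doubleton_eq_iff)
  have adj: "\<exists>t<Suc N. {ins a t, ins a (t + 1)} = {int (fib (N + 1)), int (fib (N + 2))}"
  proof (cases "a m = int (fib (N + 1))")
    case True
    then show ?thesis using new m by (intro exI[of _ m]) (auto simp: ins_def)
  next
    case False
    then have "a (m + 1) = int (fib (N + 1))" using m by (auto simp: doubleton_eq_iff)
    then show ?thesis using new m by (intro exI[of _ "m + 1"]) (auto simp: ins_def)
  qed
  have det': "ins a t * ins b (t + 1) - ins a (t + 1) * ins b t = 1" if "t < Suc N" for t
  proof -
    consider "t < m" | "t = m" | "t = m + 1" | "m + 1 < t" by linarith
    then show ?thesis
      using det[of t] det[of m] det[of "t - 1"] m that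
      by cases (auto simp: ins_def algebra_simps)
  qed
  have pos': "0 < ins a t" if "t \<le> Suc N" for t
    using pos[of t] pos[of m] pos[of "m + 1"] pos[of "t - 1"] m that
    by (auto simp: ins_def)
  have "ins a 0 = 1 \<and> ins b 0 = 0 \<and> ins a (Suc N) = 1 \<and> ins b (Suc N) = 1"
    using ends m by (auto simp: ins_def)
  then show ?case using adj det' pos' by (intro exI[of _ "ins a"] exI[of _ "ins b"]) auto
qed

text \<open>
  Translating a fraction by an integer \<open>q\<close> adds \<open>q\<close> times the denominator to the numerator and
  preserves determinants. At a period boundary the translated copies fit together because the last
  vector of the path is the translate of the first one by \<open>1\<close>.
\<close>

lemma Farey_path_periodic_extension:
  fixes a b :: "nat \<Rightarrow> int"
  assumes "N \<ge> 1" and ends: "a N = a 0" "b N = b 0 + a 0"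
    and pos: "\<And>t. t \<le> N \<Longrightarrow> 0 < a t"
    and det: "\<And>t. t < N \<Longrightarrow> a t * b (t + 1) - a (t + 1) * b t = 1"
  obtains A B :: "int \<Rightarrow> int" where "\<And>t. 0 < A t"
    "\<And>t. A t * B (t + 1) - A (t + 1) * B t = 1"
    "\<And>t. A (t + int N) = A t" "\<And>t. B (t + int N) = B t + A t"
    "\<And>t. t \<le> N \<Longrightarrow> A (int t) = a t"
proof -
  have N: "0 < int N" using assms(1) by simp
  define A where "A t = a (nat (t mod int N))" for t
  define B where "B t = b (nat (t mod int N)) + (t div int N) * a (nat (t mod int N))" for t
  have lt: "nat (t mod int N) < N" for t
    using pos_mod_bound[OF N, of t] N by (simp add: nat_less_iff)
  have next_A: "A (t + 1) = a (nat (t mod int N) + 1)" (is ?A)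
    and next_B: "B (t + 1) = b (nat (t mod int N) + 1) + (t div int N) * a (nat (t mod int N) + 1)"
      (is ?B) for t
  proof -
    define r q where "r = t mod int N" and "q = t div int N"
    have r: "0 \<le> r" "r < int N" using N by (simp_all add: r_def)
    have t: "t = r + q * int N" by (simp add: r_def q_def)
    have "?A \<and> ?B"
    proof (cases "r + 1 = int N")
      case True
      then have "t + 1 = (q + 1) * int N" by (simp add: t algebra_simps)
      then have "(t + 1) mod int N = 0" "(t + 1) div int N = q + 1" using N by simp_all
      moreover have "nat r + 1 = N" using True r by simp
      ultimately show ?thesis
        using ends unfolding A_def B_def r_def[symmetric] q_def[symmetric]
        by (simp add: algebra_simps)
    next
      case False
      then have "0 \<le> r + 1" "r + 1 < int N" using r by simp_all
      moreover have "t + 1 = (r + 1) + q * int N" by (simp add: t)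
      ultimately have "(t + 1) mod int N = r + 1" "(t + 1) div int N = q"
        using N
        by (simp_all only: mod_mult_self1 div_mult_self1 mod_pos_pos_trivial div_pos_pos_trivial)
      moreover have "nat (r + 1) = nat r + 1" using r by simp
      ultimately show ?thesis
        unfolding A_def B_def r_def[symmetric] q_def[symmetric] by simp
    qed
    then show ?A ?B by auto
  qed
  show thesis
  proof
    show "0 < A t" for t unfolding A_def by (intro pos less_imp_le lt)
    show "A t * B (t + 1) - A (t + 1) * B t = 1" for t
      using det[OF lt[of t]] unfolding next_A next_B by (simp add: A_def B_def algebra_simps)
    show "A (t + int N) = A t" "B (t + int N) = B t + A t" for t
      using N by (simp_all add: A_def B_def algebra_simps)
    show "A (int t) = a t" if "t \<le> N" for t
      using that ends by (cases "t = N") (simp_all add: A_def)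
  qed
qed

lemma Fibonacci_entry_Frieze_B:
  assumes n: "n \<ge> 2"
  shows "int (fib (n + 1)) * int (fib (n + 2)) - 1 \<in> entries cartan_B n"
proof -
  obtain a b :: "nat \<Rightarrow> int" and m where
    ends: "a 0 = 1" "b 0 = 0" "a (n + 1) = 1" "b (n + 1) = 1"
    and pos: "\<And>t. t \<le> n + 1 \<Longrightarrow> 0 < a t"
    and det: "\<And>t. t < n + 1 \<Longrightarrow> a t * b (t + 1) - a (t + 1) * b t = 1"
    and m: "m < n + 1" "{a m, a (m + 1)} = {int (fib (n + 1)), int (fib (n + 1 + 1))}"
    using Fibonacci_Farey_path[of "n + 1"] by auto
  have closed: "1 \<le> n + 1" "a (n + 1) = a 0" "b (n + 1) = b 0 + a 0" using ends by simp_all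
  obtain A B :: "int \<Rightarrow> int" where path: "\<And>t. 0 < A t"
    "\<And>t. A t * B (t + 1) - A (t + 1) * B t = 1"
    "\<And>t. A (t + int (n + 1)) = A t" "\<And>t. B (t + int (n + 1)) = B t + A t"
    and A: "\<And>t. t \<le> n + 1 \<Longrightarrow> A (int t) = a t"
    using Farey_path_periodic_extension[OF closed pos det] by blast
  define x where "x = (\<lambda>i\<in>{1..n}. \<lambda>j. if i = 1 then A (j + 1)
    else A (j + int i) * B (j + int n + 2) - A (j + int n + 2) * B (j + int i))"
  have x: "x \<in> Frieze cartan_B n"
    unfolding x_def by (rule Frieze_B_of_Farey_path[OF n path])
  define j where "j = int m - 1"
  have "x 1 j * x 1 (j + 1) = A (int m) * A (int (m + 1))"
    using n by (simp add: x_def j_def add.commute)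
  also have "\<dots> = a m * a (m + 1)" using m(1) by (simp only: A)
  also have "\<dots> = int (fib (n + 1)) * int (fib (n + 2))"
    using m(2) by (auto simp: doubleton_eq_iff)
  finally have "1 + x 2 j = int (fib (n + 1)) * int (fib (n + 2))"
    using x[unfolded Frieze_B_iff[OF n]] by metis
  then have "int (fib (n + 1)) * int (fib (n + 2)) - 1 = x 2 j" by simp
  moreover have "2 \<in> {1..n}" using n by simp
  ultimately show ?thesis using x unfolding entries_def by blast
qed

section \<open>The Fibonacci lower bounds\<close>

theorem theorem2:
  shows "(\<forall>n::nat. n \<ge> 2 \<longrightarrow>
            max_frieze_entry cartan_B n \<ge> int (fib (n + 1)) * int (fib (n + 2)) - 1)
       \<and> (\<forall>n::nat. n \<ge> 4 \<longrightarrow>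
            max_frieze_entry cartan_D n \<ge> int (fib n) * int (fib (n + 1)) - 1)"
proof (intro conjI allI impI)
  fix n :: nat assume n: "n \<ge> 2"
  have "finite (entries cartan_B n)"
    using finite_entries_D[of "n + 1"] entries_B_subset_D[OF n] n by (auto intro: finite_subset)
  then show "max_frieze_entry cartan_B n \<ge> int (fib (n + 1)) * int (fib (n + 2)) - 1"
    using Fibonacci_entry_Frieze_B[OF n] unfolding max_frieze_entry_def entries_def[symmetric]
    by (rule Max_ge)
next
  fix n :: nat assume n: "n \<ge> 4"
  then have m: "n - 1 \<ge> 2" and s: "n - 1 + 1 = n" "n - 1 + 2 = n + 1" by auto
  have "int (fib n) * int (fib (n + 1)) - 1 \<in> entries cartan_D n"
    using Fibonacci_entry_Frieze_B[OF m] entries_B_subset_D[OF m] unfolding s by auto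
  then show "max_frieze_entry cartan_D n \<ge> int (fib n) * int (fib (n + 1)) - 1"
    using finite_entries_D[of n] n unfolding max_frieze_entry_def entries_def[symmetric]
    by (intro Max_ge) auto
qed

end
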